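(* For all primes $p$ with $p\equiv 5\pmod 8$, the sum in $\mathbb{Z}$ of the quartic residues modulo $p$ (each taken as an integer in $\{1,\dots,p-1\}$) is \[ \frac{p}{5}\left(M_{11}+2M_{12}+3M_{13}+4M_{14}\right), \] where, for $j=1,2,3,4$, $M_{1j}$ is the number of quartic residues $x\in\{1,\dots,p-1\}$ with $\frac{(j-1)p}{4}<x<\frac{jp}{4}$.
   Context: The finite field $\mathbb{Z}_p$ is identified with the set of integers $\{0,1,\dots,p-1\}$, and $\mathbb{Z}_p^*=\{1,\dots,p-1\}$. The quartic residues modulo $p$ are the elements $x\in\mathbb{Z}_p^*$ with $x\equiv y^4\pmod p$ for some $y\in\mathbb{Z}_p^*$; equivalently, for any generator $g$ of the multiplicative group $\mathbb{Z}_p^*$, the elements of the form $g^k$ modulo $p$ with $k\equiv 0\pmod 4$. The numbers $M_{11},M_{12},M_{13},M_{14}$ form the first row of the $4\times4$ matrix $M$ whose $(i+1),(j+1)$-th entry ($i,j=0,1,2,3$) is the number of $x\in\mathbb{Z}_p^*$ of the form $x\equiv g^k\pmod p$ with $k\equiv i\pmod 4$ and $\frac{jp}{4}<x<\frac{(j+1)p}{4}$; this first row does not depend on the choice of $g$. *)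

theory Defs
  imports "HOL-Number_Theory.Number_Theory" Complex_Main
begin

definition quartic_residues :: "nat \<Rightarrow> nat set" where
  "quartic_residues p = {x \<in> {1..p-1}. \<exists>y\<in>{1..p-1}. [x = y ^ 4] (mod p)}"

text \<open>The parameter \<open>j\<close> runs over 1, 2, 3, 4; the value is the entry in row 1 and column \<open>j\<close>
  of the matrix counting, for each coset of the quartic residues, its elements
  in each quarter of the interval from 0 to \<open>p\<close>.\<close>

definition M1 :: "nat \<Rightarrow> nat \<Rightarrow> nat" where
  "M1 p j = card {x \<in> quartic_residues p.
     (real j - 1) * real p / 4 < real x \<and> real x < real j * real p / 4}"

end

theory Submission
  imports Defs
begin

text \<open>
  Modulo a prime \<open>p\<close> with \<open>p mod 4 = 1\<close> there is a square root \<open>i\<close> of \<open>- 1\<close>, and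
  \<open>(1 + i) ^ 4 = (2 * i) ^ 2 = - 4\<close>.  So \<open>- 4\<close> is a fourth power, and multiplication by
  \<open>- 4\<close> permutes the set \<open>R\<close> of quartic residues.  If \<open>x\<close> lies in the \<open>j\<close>-th quarter
  of the interval from \<open>0\<close> to \<open>p\<close>, then \<open>j * p - 4 * x\<close> lies between \<open>0\<close> and \<open>p\<close>, so this
  number is the representative of \<open>- 4 * x\<close>.  The sum \<open>S\<close> of \<open>R\<close> is also the sum of
  these representatives, whence \<open>S = p * (M\<^sub>1\<^sub>1 + 2 * M\<^sub>1\<^sub>2 + 3 * M\<^sub>1\<^sub>3 + 4 * M\<^sub>1\<^sub>4) - 4 * S\<close>,
  which is the claim.
\<close>

text \<open>
  A square root \<open>i\<close> of \<open>- 1\<close> exists by Euler's criterion, as \<open>(p - 1) div 2\<close> is even; the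
  fourth root of \<open>- 4\<close> is \<open>1 + i\<close>.
\<close>

lemma minus_four_is_fourth_power:
  fixes p :: nat
  assumes "prime p" and "p mod 4 = 1"
  obtains u :: int where "[u ^ 4 = - 4] (mod int p)"
proof -
  from assms(2) have "p \<noteq> 2" by auto
  with prime_ge_2_nat[OF assms(1)] have "2 < p" by linarith
  have "[Legendre (- 1) (int p) = (- 1) ^ ((p - 1) div 2)] (mod int p)"
    using euler_criterion[OF assms(1) \<open>2 < p\<close>] by simp
  moreover have "even ((p - 1) div 2)"
    using assms(2) by presburger
  ultimately have "[Legendre (- 1) (int p) = 1] (mod int p)"
    by simp
  then have "QuadRes (int p) (- 1)"
    using \<open>2 < p\<close> by (auto simp: Legendre_def cong_iff_dvd_diff zdvd_not_zless split: if_splits)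
  then obtain i where i: "[i ^ 2 = - 1] (mod int p)"
    unfolding QuadRes_def by blast
  \<comment> \<open>the quotient of the polynomials \<open>(1 + i) ^ 4 + 4\<close> and \<open>i ^ 2 + 1\<close> in \<open>i\<close>\<close>
  have "(1 + i) ^ 4 - (- 4) = (i ^ 2 + 4 * i + 5) * (i ^ 2 - (- 1))"
    by (simp add: algebra_simps power2_eq_square power4_eq_xxxx)
  then have "[(1 + i) ^ 4 = - 4] (mod int p)"
    using i unfolding cong_iff_dvd_diff by simp
  then show thesis by (rule that)
qed

text \<open>
  Allowing an arbitrary integer as fourth root means that products of roots need not be
  reduced to the range from \<open>1\<close> to \<open>p - 1\<close>; a root is nonzero modulo \<open>p\<close> because its
  fourth power is.
\<close>

lemma mem_quartic_residues_iff:
  fixes p x :: nat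
  shows "x \<in> quartic_residues p \<longleftrightarrow>
    0 < x \<and> x < p \<and> (\<exists>z::int. [int x = z ^ 4] (mod int p))"
proof
  assume "x \<in> quartic_residues p"
  then obtain y where x: "x \<in> {1..p - 1}" and "[x = y ^ 4] (mod p)"
    unfolding quartic_residues_def by blast
  then have "[int x = int y ^ 4] (mod int p)"
    by (metis cong_int_iff of_nat_power)
  with x show "0 < x \<and> x < p \<and> (\<exists>z::int. [int x = z ^ 4] (mod int p))"
    by auto
next
  assume "0 < x \<and> x < p \<and> (\<exists>z::int. [int x = z ^ 4] (mod int p))"
  then obtain z where x: "0 < x" "x < p" and z: "[int x = z ^ 4] (mod int p)"
    by blast
  define y where "y = nat (z mod int p)"
  have p: "0 < int p"
    using x by simp
  then have int_y: "int y = z mod int p"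
    unfolding y_def by simp
  then have "[z ^ 4 = int y ^ 4] (mod int p)"
    by (intro cong_pow) (simp add: cong_def)
  with z have "[int x = int y ^ 4] (mod int p)"
    by (rule cong_trans)
  then have xy: "[x = y ^ 4] (mod p)"
    by (simp only: cong_int_iff flip: of_nat_power)
  have "y \<noteq> 0"
  proof
    assume "y = 0"
    with xy have "p dvd x" by (simp add: cong_0_iff)
    with x show False by (auto dest: dvd_imp_le)
  qed
  moreover have "y < p"
    using int_y p by (metis pos_mod_bound of_nat_less_iff)
  ultimately have "y \<in> {1..p - 1}" "x \<in> {1..p - 1}"
    using x by auto
  with xy show "x \<in> quartic_residues p"
    unfolding quartic_residues_def by blast
qed

lemma finite_quartic_residues [simp]: "finite (quartic_residues p)"
  unfolding quartic_residues_def by simp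

lemma not_dvd_four_mult:
  fixes p x :: nat
  assumes "odd p" and "0 < x" and "x < p"
  shows "\<not> p dvd 4 * x"
proof -
  have "coprime 4 p"
    using assms(1) coprime_power_left_iff[of 2 2 p] by simp
  then have "p dvd 4 * x \<longleftrightarrow> p dvd x"
    by (simp add: coprime_commute coprime_dvd_mult_right_iff)
  with assms show ?thesis
    by (auto dest: dvd_imp_le)
qed

text \<open>
  The map below is multiplication by \<open>- 4\<close> on representatives: for \<open>x\<close> prime to \<open>p\<close> the
  residue \<open>4 * x mod p\<close> does not vanish, and its negative is represented by \<open>p - 4 * x mod p\<close>.
\<close>

lemma minus_four_permutes_quartic_residues:
  fixes p :: nat
  assumes "prime p" and "p mod 4 = 1"
  shows "bij_betw (\<lambda>x. p - 4 * x mod p) (quartic_residues p) (quartic_residues p)"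
proof -
  let ?f = "\<lambda>x. p - 4 * x mod p" and ?R = "quartic_residues p"
  have "0 < p"
    using assms(1) prime_gt_0_nat by simp
  have "odd p"
    using assms(2) by presburger
  then have coprime: "coprime 4 p"
    using coprime_power_left_iff[of 2 2 p] by simp
  have f: "[int (?f x) = - 4 * int x] (mod int p)" for x
  proof -
    have "int (?f x) = int p - 4 * int x mod int p"
      using \<open>0 < p\<close> by (simp add: of_nat_diff zmod_int less_imp_le)
    then have "int (?f x) - (- 4 * int x) = int p + int p * (4 * int x div int p)"
      by (simp add: minus_mod_eq_mult_div [symmetric])
    then show ?thesis
      unfolding cong_iff_dvd_diff by simp
  qed
  obtain u :: int where u: "[u ^ 4 = - 4] (mod int p)"
    using minus_four_is_fourth_power[OF assms] .
  have "?f ` ?R \<subseteq> ?R"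
  proof (rule image_subsetI)
    fix x assume "x \<in> ?R"
    then obtain z :: int where x: "0 < x" "x < p" and z: "[int x = z ^ 4] (mod int p)"
      using mem_quartic_residues_iff by blast
    have "[- 4 * int x = u ^ 4 * z ^ 4] (mod int p)"
      using u z by (intro cong_mult) (simp_all add: cong_sym)
    with f[of x] have "[int (?f x) = (u * z) ^ 4] (mod int p)"
      unfolding power_mult_distrib by (rule cong_trans)
    moreover have "0 < 4 * x mod p"
      using not_dvd_four_mult[OF \<open>odd p\<close> x] by (simp add: mod_greater_zero_iff_not_dvd)
    ultimately show "?f x \<in> ?R"
      using \<open>0 < p\<close> mem_quartic_residues_iff by auto
  qed
  moreover have "inj_on ?f ?R"
  proof (rule inj_onI)
    fix x y assume mem: "x \<in> ?R" "y \<in> ?R" and "?f x = ?f y"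
    moreover have "4 * x mod p < p" "4 * y mod p < p"
      using \<open>0 < p\<close> by simp_all
    ultimately have "[4 * x = 4 * y] (mod p)"
      unfolding cong_def by linarith
    then have "[x = y] (mod p)"
      using coprime cong_mult_lcancel_nat by blast
    moreover have "x < p" "y < p"
      using mem mem_quartic_residues_iff by blast+
    ultimately show "x = y"
      using cong_less_modulus_unique_nat by blast
  qed
  ultimately show ?thesis
    by (simp add: bij_betw_def endo_inj_surj)
qed

text \<open>
  As \<open>4 * x\<close> is never a multiple of \<open>p\<close>, no \<open>x\<close> lies on the boundary between two quarters,
  so the strict inequalities on both sides can be replaced by a floor.
\<close>

lemma quarter_iff:
  fixes p x j :: nat
  assumes "odd p" and "0 < x" and "x < p"
  shows "(real j - 1) * real p / 4 < real x \<and> real x < real j * real p / 4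
    \<longleftrightarrow> 4 * x div p + 1 = j"
proof -
  define q r where "q = 4 * x div p" and "r = 4 * x mod p"
  have "0 < r"
    unfolding r_def using not_dvd_four_mult[OF assms]
    by (simp add: mod_greater_zero_iff_not_dvd)
  moreover have "r < p"
    unfolding r_def using assms(2,3) by simp
  moreover have "4 * x = p * q + r"
    unfolding q_def r_def by (rule mult_div_mod_eq [symmetric])
  ultimately have lower: "p * q < 4 * x" and upper: "4 * x < p * q + p"
    by linarith+
  have "(real j - 1) * real p / 4 < real x \<longleftrightarrow> j * p < 4 * x + p"
    using of_nat_less_iff[of "j * p" "4 * x + p", where ?'a = real]
    by (simp add: field_simps)
  moreover have "real x < real j * real p / 4 \<longleftrightarrow> 4 * x < j * p"
    using of_nat_less_iff[of "4 * x" "j * p", where ?'a = real]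
    by (simp add: field_simps)
  moreover have "j * p < 4 * x + p \<and> 4 * x < j * p \<longleftrightarrow> q + 1 = j"
  proof
    assume j: "j * p < 4 * x + p \<and> 4 * x < j * p"
    then have "p * j < p * (q + 2)" "p * q < p * j"
      using lower upper unfolding distrib_left mult.commute[of j p] by linarith+
    then show "q + 1 = j" unfolding mult_less_cancel1 by linarith
  next
    assume "q + 1 = j"
    with lower upper show "j * p < 4 * x + p \<and> 4 * x < j * p"
      by (auto simp: algebra_simps)
  qed
  ultimately show ?thesis
    unfolding q_def by blast
qed

text \<open>
  Each quartic residue \<open>x\<close> contributes the number of its quarter, \<open>4 * x div p + 1\<close>, so
  the weighted sum of the counts can be taken residue by residue.
\<close>

lemma sum_quarter_numbers:
  fixes p :: nat
  assumes "odd p"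
  shows "(\<Sum>x\<in>quartic_residues p. 4 * x div p + 1) =
    M1 p 1 + 2 * M1 p 2 + 3 * M1 p 3 + 4 * M1 p 4"
proof -
  let ?R = "quartic_residues p" and ?q = "\<lambda>x. 4 * x div p + 1"
  have R: "0 < x" "x < p" if "x \<in> ?R" for x
    using that unfolding quartic_residues_def by auto
  have M1: "M1 p j = card {x \<in> ?R. ?q x = j}" for j
    unfolding M1_def
    by (rule arg_cong[where f = card]) (use quarter_iff[OF assms] R in blast)
  have "?q x \<in> {1, 2, 3, 4}" if "x \<in> ?R" for x
  proof -
    have "4 * x div p < 4"
      using R[OF that] by (simp add: less_mult_imp_div_less)
    then show ?thesis by auto
  qed
  then have "?q ` ?R \<subseteq> {1, 2, 3, 4}"
    by (rule image_subsetI)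
  then have "(\<Sum>x\<in>?R. ?q x) = (\<Sum>j\<in>{1, 2, 3, 4}. \<Sum>x\<in>{x \<in> ?R. ?q x = j}. ?q x)"
    by (intro sum.group [symmetric]) simp_all
  also have "\<dots> = (\<Sum>j\<in>{1, 2, 3, 4}. j * M1 p j)"
    unfolding M1 by (intro sum.cong [OF refl]) (simp add: mult.commute)
  finally show ?thesis by simp
qed

theorem theorem2:
  fixes p :: nat
  assumes "prime p" and "[p = 5] (mod 8)"
  shows "real (\<Sum>x\<in>quartic_residues p. x) =
    real p / 5 * real (M1 p 1 + 2 * M1 p 2 + 3 * M1 p 3 + 4 * M1 p 4)"
proof -
  let ?R = "quartic_residues p"
  let ?W = "M1 p 1 + 2 * M1 p 2 + 3 * M1 p 3 + 4 * M1 p 4"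
  have "p mod 8 = 5"
    using assms(2) by (simp add: cong_def)
  then have "p mod 4 = 1" "odd p"
    by presburger+
  have "0 < p"
    using assms(1) prime_gt_0_nat by simp
  \<comment> \<open>the representative of \<open>- 4 * x\<close> is \<open>j * p - 4 * x\<close>, with \<open>j = 4 * x div p + 1\<close> the quarter of \<open>x\<close>\<close>
  have "(p - 4 * x mod p) + 4 * x = p * (4 * x div p + 1)" for x
  proof -
    have "4 * x mod p \<le> p" "4 * x = p * (4 * x div p) + 4 * x mod p"
      using \<open>0 < p\<close> by (simp_all add: less_imp_le)
    then show ?thesis unfolding distrib_left by linarith
  qed
  then have "(\<Sum>x\<in>?R. p - 4 * x mod p) + 4 * (\<Sum>x\<in>?R. x) = p * (\<Sum>x\<in>?R. 4 * x div p + 1)"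
    unfolding sum_distrib_left sum.distrib [symmetric] by (rule sum.cong [OF refl])
  moreover have "(\<Sum>x\<in>?R. p - 4 * x mod p) = (\<Sum>x\<in>?R. x)"
    using minus_four_permutes_quartic_residues[OF assms(1) \<open>p mod 4 = 1\<close>]
    by (rule sum.reindex_bij_betw)
  ultimately have "5 * (\<Sum>x\<in>?R. x) = p * ?W"
    unfolding sum_quarter_numbers[OF \<open>odd p\<close>] by linarith
  then have "real (5 * (\<Sum>x\<in>?R. x)) = real (p * ?W)"
    by (rule arg_cong)
  then have "5 * real (\<Sum>x\<in>?R. x) = real p * real ?W"
    unfolding of_nat_mult by simp
  then show ?thesis by simp
qed

end
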